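(* Let $\lambda_1,\lambda,\alpha,\beta,a>0$. Let $N_1$ be a Poisson process with intensity $\lambda_1$, $N$ a Poisson process with intensity $\lambda$, and $G$ the Gamma process with parameters $(\alpha,\beta)$, all independent, and let $G_{N+a}(t)=G(N(t)+at)$. Then for all integers $k\ge0$ and $t>0$ the probability mass function of $N_1(G_{N+a}(t))$ is $$p_k(t)=P\{N_1(G_{N+a}(t))=k\}=e^{-\lambda t}\frac{\lambda_1^k}{k!}\sum_{n=0}^{\infty}\frac{(\lambda t)^n}{n!}\frac{\beta^{\alpha(n+at)}}{\Gamma(\alpha(n+at))}\frac{\Gamma(\alpha(n+at)+k)}{(\lambda_1+\beta)^{\alpha(n+at)+k}},$$ and the probabilities $p_k(t)$, $k\ge 0$, satisfy the system of difference-differential equations $$\frac{d}{dt}p_k(t)=-\left(a\alpha\log\left(1+\frac{\lambda_1}{\beta}\right)+\lambda\left(1-\left(\frac{\beta}{\lambda_1+\beta}\right)^{\alpha}\right)\right)p_k(t)+\sum_{m=1}^{k}\frac{1}{m!}\left(\frac{\lambda_1}{\lambda_1+\beta}\right)^m\left(a\alpha\,\Gamma(m)+\lambda\left(\frac{\beta}{\lambda_1+\beta}\right)^{\alpha}\frac{\Gamma(m+\alpha)}{\Gamma(\alpha)}\right)p_{k-m}(t).$$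
   Context: The Gamma process with parameters $(\alpha,\beta)$ is the subordinator with Laplace exponent $\alpha\log(1+u/\beta)$, i.e. $E e^{-uG(t)}=(1+u/\beta)^{-\alpha t}$. *)

theory Defs
  imports "HOL-Probability.Probability"
begin

definition independent_increments :: "'w measure \<Rightarrow> (real \<Rightarrow> 'w \<Rightarrow> real) \<Rightarrow> bool" where
  "independent_increments M X \<longleftrightarrow>
    (\<forall>n (\<tau> :: nat \<Rightarrow> real). 0 \<le> \<tau> 0 \<and> (\<forall>i<n. \<tau> i \<le> \<tau> (Suc i)) \<longrightarrow>
      prob_space.indep_vars M (\<lambda>_. borel) (\<lambda>i \<omega>. X (\<tau> (Suc i)) \<omega> - X (\<tau> i) \<omega>) {..<n})"

definition stationary_increments :: "'w measure \<Rightarrow> (real \<Rightarrow> 'w \<Rightarrow> real) \<Rightarrow> bool" where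
  "stationary_increments M X \<longleftrightarrow>
    (\<forall>s\<ge>0. \<forall>t\<ge>0. distr M borel (\<lambda>\<omega>. X (s + t) \<omega> - X s \<omega>) = distr M borel (\<lambda>\<omega>. X t \<omega> - X 0 \<omega>))"

text \<open>Processes are indexed by \<open>[0,\<infinity>)\<close>; their values at negative times are irrelevant.
  The path properties are required for every sample point. In particular this makes a
  subordinator evaluated at an independent random time a random variable. Left limits
  exist by monotonicity.\<close>

definition subordinator :: "'w measure \<Rightarrow> (real \<Rightarrow> 'w \<Rightarrow> real) \<Rightarrow> bool" where
  "subordinator M X \<longleftrightarrow>
    (\<forall>t\<ge>0. X t \<in> borel_measurable M) \<and>
    (\<forall>\<omega>\<in>space M. X 0 \<omega> = 0) \<and>
    independent_increments M X \<and>
    stationary_increments M X \<and>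
    (\<forall>\<omega>\<in>space M. mono_on {0..} (\<lambda>t. X t \<omega>)) \<and>
    (\<forall>\<omega>\<in>space M. \<forall>t\<ge>0. continuous (at_right t) (\<lambda>t. X t \<omega>))"

definition has_laplace_exponent ::
  "'w measure \<Rightarrow> (real \<Rightarrow> 'w \<Rightarrow> real) \<Rightarrow> (real \<Rightarrow> real) \<Rightarrow> bool" where
  "has_laplace_exponent M X \<phi> \<longleftrightarrow>
    (\<forall>t\<ge>0. \<forall>u\<ge>0. prob_space.expectation M (\<lambda>\<omega>. exp (- u * X t \<omega>)) = exp (- t * \<phi> u))"

definition gamma_process :: "'w measure \<Rightarrow> real \<Rightarrow> real \<Rightarrow> (real \<Rightarrow> 'w \<Rightarrow> real) \<Rightarrow> bool" where
  "gamma_process M \<alpha> \<beta> G \<longleftrightarrow>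
    subordinator M G \<and> has_laplace_exponent M G (\<lambda>u. \<alpha> * ln (1 + u / \<beta>))"

text \<open>The law at time \<open>0\<close> is fixed by \<open>N 0 = 0\<close>; \<open>poisson_pmf\<close> is only specified
  for positive rates.\<close>

definition poisson_process :: "'w measure \<Rightarrow> real \<Rightarrow> (real \<Rightarrow> 'w \<Rightarrow> nat) \<Rightarrow> bool" where
  "poisson_process M r N \<longleftrightarrow>
    subordinator M (\<lambda>t \<omega>. real (N t \<omega>)) \<and>
    (\<forall>t>0. distr M (count_space UNIV) (N t) = measure_pmf (poisson_pmf (r * t)))"

text \<open>Mutual independence of the processes in the list \<open>Xs\<close>, each viewed as one random
  element of the product space of functions on \<open>[0,\<infinity>)\<close>.\<close>

definition independent_processes :: "'w measure \<Rightarrow> (real \<Rightarrow> 'w \<Rightarrow> real) list \<Rightarrow> bool" where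
  "independent_processes M Xs \<longleftrightarrow>
    prob_space.indep_vars M (\<lambda>_. PiM {0..} (\<lambda>_. borel))
      (\<lambda>i \<omega>. \<lambda>t\<in>{0..}. (Xs ! i) t \<omega>) {..<length Xs}"

definition time_changed ::
  "(real \<Rightarrow> 'w \<Rightarrow> real) \<Rightarrow> (real \<Rightarrow> 'w \<Rightarrow> nat) \<Rightarrow> real \<Rightarrow> real \<Rightarrow> 'w \<Rightarrow> real" where
  "time_changed G N a t \<omega> = G (real (N t \<omega>) + a * t) \<omega>"

definition time_changed_pmf ::
  "'w measure \<Rightarrow> (real \<Rightarrow> 'w \<Rightarrow> nat) \<Rightarrow> (real \<Rightarrow> 'w \<Rightarrow> real) \<Rightarrow> (real \<Rightarrow> 'w \<Rightarrow> nat) \<Rightarrow>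
    real \<Rightarrow> nat \<Rightarrow> real \<Rightarrow> real" where
  "time_changed_pmf M N1 G N a k t =
    measure M {\<omega> \<in> space M. N1 (time_changed G N a t \<omega>) \<omega> = k}"

end

(* Conditioning on N(t) and G reduces everything to c_k(s) = P{N1(G(s)) = k}, the mean of the Poisson
   mass at lam1 G(s).  The law of G(s) is never needed: the generating function of k |-> c_k(s)
   at z is the Laplace transform of G(s) at lam1 (1 - z), a binomial series, so c_k(s) is a
   negative binomial mass with real shape parameter alpha s.  These masses form a convolution
   semigroup in s.  Its unit step gives the jump terms of the differential equation and its
   derivative at 0 gives the drift terms, via
   d/dt E c(N(t) + a t) = lam E (c(N(t) + a t + 1) - c(N(t) + a t)) + a E c'(N(t) + a t). *)

theory Submission
  imports Defs "HOL-Complex_Analysis.Cauchy_Integral_Formula"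
begin

section \<open>Negative binomial masses with real shape parameter\<close>

text \<open>The negative binomial law with real shape \<open>x\<close>, written with a rising
  factorial rather than a quotient of Gamma values: the expression is then smooth in
  \<open>x\<close> also at the pole \<open>x = 0\<close>, where the semigroup is
  differentiated.\<close>

definition nbinomial :: "real \<Rightarrow> real \<Rightarrow> nat \<Rightarrow> real" where
  "nbinomial p x k = (1 - p) powr x * p ^ k * pochhammer x k / fact k"

lemma nbinomial_0_right [simp]: "nbinomial p x 0 = (1 - p) powr x"
  by (simp add: nbinomial_def)

text \<open>Vandermonde's identity for rising factorials gives the convolution; the powers of
  \<open>1 - p\<close> and \<open>p\<close> split as products.\<close>

lemma nbinomial_add:
  assumes "p < 1"
  shows "nbinomial p (x + y) k = (\<Sum>m\<le>k. nbinomial p x m * nbinomial p y (k - m))"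
proof -
  have "pochhammer (x + y) k / fact k =
      (\<Sum>m\<le>k. (pochhammer x m / fact m) * (pochhammer y (k - m) / fact (k - m)))"
    by (simp add: pochhammer_binomial_sum binomial_fact sum_divide_distrib)
  then have "nbinomial p (x + y) k = (1 - p) powr x * (1 - p) powr y * p ^ k *
      (\<Sum>m\<le>k. (pochhammer x m / fact m) * (pochhammer y (k - m) / fact (k - m)))"
    using assms by (simp only: nbinomial_def powr_add times_divide_eq_right[symmetric])
  also have "\<dots> = (\<Sum>m\<le>k. (1 - p) powr x * (1 - p) powr y * (p ^ m * p ^ (k - m)) *
      ((pochhammer x m / fact m) * (pochhammer y (k - m) / fact (k - m))))"
    by (simp add: sum_distrib_left flip: power_add)
  finally show ?thesis
    by (simp add: nbinomial_def mult_ac)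
qed

text \<open>After the factor \<open>x\<close> is split off, the difference quotient at 0 is
  \<open>pochhammer (x + 1) n\<close>, which tends to \<open>pochhammer 1 n\<close>, that is
  \<open>fact n\<close>.\<close>

lemma has_real_derivative_pochhammer_0:
  "((\<lambda>x. pochhammer x (Suc n)) has_real_derivative fact n) (at 0)"
proof -
  have "continuous (at 0) (\<lambda>x::real. pochhammer (x + 1) n)"
    unfolding pochhammer_prod by (intro continuous_intros)
  then have "((\<lambda>x::real. x * pochhammer (x + 1) n) has_real_derivative pochhammer (0 + 1) n) (at 0)"
    by (simp add: has_field_derivative_iff continuous_at cong: LIM_cong)
  then show ?thesis
    by (simp add: pochhammer_rec pochhammer_fact)
qed

lemma has_real_derivative_nbinomial:
  assumes "p < 1"
  shows "((\<lambda>x. nbinomial p x k) has_real_derivative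
      ln (1 - p) * nbinomial p x k + (\<Sum>m=1..k. p ^ m / m * nbinomial p x (k - m))) (at x)"
proof -
  \<comment> \<open>\<open>d m\<close> is the derivative at shape 0, the generator of the
    convolution semigroup. For positive \<open>m\<close> the weights \<open>p ^ m / m\<close> form
    its jump measure, a logarithmic series.\<close>
  define d where "d m = (if m = 0 then ln (1 - p) else p ^ m / m)" for m
  have d: "((\<lambda>y. nbinomial p y m) has_real_derivative d m) (at 0)" for m
  proof (cases m)
    case 0
    then show ?thesis
      using assms by (auto simp: d_def intro!: derivative_eq_intros)
  next
    case (Suc n)
    \<comment> \<open>Since \<open>pochhammer 0 m\<close> vanishes for positive \<open>m\<close>,
      the product rule leaves only the term in which the rising factorial is differentiated.\<close>
    have "((\<lambda>y. (1 - p) powr y * p ^ m * pochhammer y m / fact m) has_real_derivative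
        p ^ m * fact n / fact m) (at 0)"
      unfolding Suc using assms has_real_derivative_pochhammer_0[of n]
      by (auto intro!: derivative_eq_intros simp: pochhammer_rec[of "0::real"])
    then show ?thesis
      by (simp add: Suc d_def nbinomial_def)
  qed
  \<comment> \<open>By additivity in \<open>x\<close> it suffices to differentiate at \<open>0\<close>.\<close>
  have "((\<lambda>y. \<Sum>m\<le>k. nbinomial p y m * nbinomial p x (k - m)) has_real_derivative
      (\<Sum>m\<le>k. d m * nbinomial p x (k - m))) (at 0)"
    by (intro DERIV_sum DERIV_cmult_right d)
  then have "((\<lambda>y. nbinomial p (y + x) k) has_real_derivative
      (\<Sum>m\<le>k. d m * nbinomial p x (k - m))) (at 0)"
    using assms by (simp add: nbinomial_add)
  then have "((\<lambda>y. nbinomial p y k) has_real_derivative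
      (\<Sum>m\<le>k. d m * nbinomial p x (k - m))) (at x)"
    using DERIV_shift[of "\<lambda>y. nbinomial p y k" _ 0 x] by simp
  also have "{..k} = insert 0 {1..k}"
    by auto
  finally show ?thesis
    by (simp add: d_def)
qed

text \<open>This is the binomial series with exponent \<open>- x\<close> at
  \<open>- (p * z)\<close>. As \<open>p < 1\<close>, it converges also at \<open>z = 1\<close>,
  where it shows that the masses sum to 1.\<close>

lemma nbinomial_sums:
  assumes "0 < p" "p < 1" "\<bar>z\<bar> \<le> 1"
  shows "(\<lambda>k. nbinomial p x k * z ^ k) sums ((1 - p) / (1 - p * z)) powr x"
proof -
  have "p * \<bar>z\<bar> \<le> p * 1"
    using assms by (intro mult_left_mono) auto
  moreover have "\<bar>p * z\<bar> = p * \<bar>z\<bar>"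
    using assms by (simp add: abs_mult)
  ultimately have pz: "\<bar>p * z\<bar> < 1"
    using assms by linarith
  have "(\<lambda>k. (1 - p) powr x * ((- x gchoose k) * (- (p * z)) ^ k)) sums
      ((1 - p) powr x * (1 + - (p * z)) powr - x)"
    using pz by (intro sums_mult gen_binomial_real) simp
  moreover have "(- x gchoose k) * (- (p * z)) ^ k = p ^ k * z ^ k * pochhammer x k / fact k" for k
    by (simp add: gbinomial_pochhammer power_minus[of "p * z"] power_mult_distrib)
  moreover have "(1 - p) powr x * (1 + - (p * z)) powr - x = ((1 - p) / (1 - p * z)) powr x"
    using assms pz by (simp add: powr_divide powr_minus divide_simps)
  ultimately show ?thesis
    by (simp add: nbinomial_def mult_ac)
qed

lemma nbinomial_nonneg:
  assumes "0 < p" "p < 1" "0 \<le> x"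
  shows "0 \<le> nbinomial p x k"
  using assms by (auto simp: nbinomial_def pochhammer_prod intro!: prod_nonneg mult_nonneg_nonneg divide_nonneg_nonneg)

lemma nbinomial_le_1:
  assumes "0 < p" "p < 1" "0 \<le> x"
  shows "nbinomial p x k \<le> 1"
proof -
  have "(\<lambda>k. nbinomial p x k) sums 1"
    using nbinomial_sums[OF assms(1,2), of 1 x] assms by simp
  then have "sum (nbinomial p x) {k} \<le> 1"
    using sum_le_suminf[of "nbinomial p x" "{k}"] nbinomial_nonneg[OF assms]
    by (simp add: sums_iff)
  then show ?thesis by simp
qed

section \<open>Termwise differentiation of Poisson-weighted series\<close>

text \<open>Differentiating \<open>(lam * t) ^ n / fact n\<close> lowers the index by one, which
  turns into the shift of \<open>c\<close> by 1. Bounded \<open>c\<close> and \<open>c'\<close>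
  leave exponential series as majorants, so the Weierstrass test allows differentiation term by
  term.\<close>

lemma has_real_derivative_poisson_series:
  fixes c c' :: "real \<Rightarrow> real"
  assumes "0 < a" "0 < t"
    and c: "\<And>s. s > 0 \<Longrightarrow> (c has_real_derivative c' s) (at s)"
    and B: "\<And>s. s > 0 \<Longrightarrow> \<bar>c s\<bar> \<le> B" and B': "\<And>s. s > 0 \<Longrightarrow> \<bar>c' s\<bar> \<le> B'"
  shows "((\<lambda>t. \<Sum>n. (lam * t) ^ n / fact n * c (real n + a * t)) has_real_derivative
      lam * (\<Sum>n. (lam * t) ^ n / fact n * c (real n + a * t + 1)) +
      a * (\<Sum>n. (lam * t) ^ n / fact n * c' (real n + a * t))) (at t)"
proof -
  define e where "e y n = y ^ n / fact n" for y :: real and n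
  \<comment> \<open>\<open>d y n\<close> is the derivative of \<open>e y n\<close> in
    \<open>y\<close>. At \<open>n = 0\<close> the truncated exponent \<open>n - 1\<close> is
    harmless because the factor \<open>real n\<close> is 0.\<close>
  define d where "d y n = real n * y ^ (n - 1) / fact n" for y :: real and n
  have d_0: "d y 0 = 0" and d_Suc: "d y (Suc n) = e y n" for y n
    by (simp_all add: d_def e_def field_simps del: of_nat_Suc)
  have e_summable: "summable (e y)" for y
    using summable_exp[of y] by (simp add: e_def[abs_def] field_simps)
  have d_summable: "summable (d y)" for y
    using e_summable[of y] by (subst summable_Suc_iff[symmetric]) (simp add: d_Suc)
  have pos: "0 < real n + a * x" if "0 < x" for n x
    using assms that by (simp add: add_nonneg_pos)
  \<comment> \<open>An open interval around \<open>t\<close> on which the arguments of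
    \<open>c\<close> stay positive and \<open>\<bar>lam * x\<bar>\<close> stays below a constant,
    called \<open>T\<close> further down.\<close>
  define S where "S = {0<..<t + 1}"
  define f' where "f' n x = lam * d (lam * x) n * c (real n + a * x) + e (lam * x) n * (a * c' (real n + a * x))" for n x
  have deriv: "((\<lambda>x. e (lam * x) n * c (real n + a * x)) has_real_derivative f' n x) (at x within S)"
    if "x \<in> S" for n x
  proof -
    have x: "0 < x" using that by (simp add: S_def)
    have "((\<lambda>x. c (real n + a * x)) has_real_derivative c' (real n + a * x) * a) (at x)"
      by (rule DERIV_chain2[where g="\<lambda>x. real n + a * x", OF c[OF pos[OF x]]]) (auto intro!: derivative_eq_intros)
    then have "((\<lambda>x. e (lam * x) n * c (real n + a * x)) has_real_derivative f' n x) (at x)"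
      unfolding e_def f'_def d_def by (auto intro!: derivative_eq_intros simp: add_divide_distrib mult_ac)
    then show ?thesis
      by (rule has_field_derivative_at_within)
  qed
  define T where "T = \<bar>lam\<bar> * (t + 1)"
  have e_le: "\<bar>e (lam * x) n\<bar> \<le> e T n" and d_le: "\<bar>d (lam * x) n\<bar> \<le> d T n" if "x \<in> S" for x n
  proof -
    have "\<bar>lam * x\<bar> \<le> T"
      using that by (auto simp: T_def S_def abs_mult intro!: mult_left_mono)
    then show "\<bar>e (lam * x) n\<bar> \<le> e T n" and "\<bar>d (lam * x) n\<bar> \<le> d T n"
      by (auto simp: e_def d_def abs_mult power_abs intro!: divide_right_mono mult_left_mono power_mono)
  qed
  have f'_le: "norm (f' n x) \<le> \<bar>lam\<bar> * (d T n * B) + e T n * (a * B')" if "x \<in> S" for n x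
  proof -
    have p: "0 < real n + a * x"
      using that pos by (simp add: S_def)
    have "norm (f' n x) \<le> \<bar>lam\<bar> * (\<bar>d (lam * x) n\<bar> * \<bar>c (real n + a * x)\<bar>) +
        \<bar>e (lam * x) n\<bar> * (a * \<bar>c' (real n + a * x)\<bar>)"
      unfolding f'_def real_norm_def using assms(1) by (intro order_trans[OF abs_triangle_ineq]) (simp add: abs_mult mult_ac)
    also have "\<dots> \<le> \<bar>lam\<bar> * (d T n * B) + e T n * (a * B')"
      using e_le[OF that] d_le[OF that] B[OF p] B'[OF p] assms(1)
      by (intro add_mono mult_left_mono mult_mono) (auto intro: order_trans[OF abs_ge_zero])
    finally show ?thesis .
  qed
  have unif: "uniformly_convergent_on S (\<lambda>n x. \<Sum>i<n. f' i x)"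
    by (rule Weierstrass_m_test'[OF f'_le])
      (auto intro!: summable_add summable_mult summable_mult2 d_summable e_summable)
  have summable: "summable (\<lambda>n. e y n * g (real n + a * t))"
    if "\<And>s. s > 0 \<Longrightarrow> \<bar>g s\<bar> \<le> K" for g K y
  proof (rule summable_comparison_test'[where N=0])
    show "summable (\<lambda>n. e \<bar>y\<bar> n * K)"
      by (intro summable_mult2 e_summable)
    show "norm (e y n * g (real n + a * t)) \<le> e \<bar>y\<bar> n * K" for n
      using that[OF pos[OF assms(2), of n]]
      by (auto simp: abs_mult e_def power_abs intro!: mult_left_mono divide_right_mono)
  qed
  have "t \<in> S" "t \<in> interior S" "convex S"
    using assms(2) by (auto simp: S_def interior_open)
  \<comment> \<open>The theorem takes uniform convergence of the derived series on \<open>S\<close>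
    and convergence of the series itself at one point, here \<open>t\<close>.\<close>
  from has_field_derivative_series'(2)[OF this(3) deriv unif this(1) summable this(2), OF _ B]
  have *: "((\<lambda>t. \<Sum>n. e (lam * t) n * c (real n + a * t)) has_real_derivative (\<Sum>n. f' n t)) (at t)"
    by simp
  have B1: "\<bar>c (s + 1)\<bar> \<le> B" if "0 < s" for s
    using B[of "s + 1"] that by simp
  have s1: "(\<lambda>n. lam * (e (lam * t) n * c (real n + a * t + 1))) sums
      (lam * (\<Sum>n. e (lam * t) n * c (real n + a * t + 1)))"
    by (rule sums_mult[OF summable_sums[OF summable[where g="\<lambda>s. c (s + 1)", OF B1]]])
  moreover have "real (Suc n) + a * t = real n + a * t + 1" for n
    by simp
  ultimately have "(\<lambda>n. lam * d (lam * t) (Suc n) * c (real (Suc n) + a * t)) sums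
      (lam * (\<Sum>n. e (lam * t) n * c (real n + a * t + 1)))"
    by (simp only: d_Suc mult.assoc)
  \<comment> \<open>Reindexing: the term with \<open>n = 0\<close> vanishes by \<open>d_0\<close>,
    so the sum over successors is the full sum.\<close>
  then have s1': "(\<lambda>n. lam * d (lam * t) n * c (real n + a * t)) sums
      (lam * (\<Sum>n. e (lam * t) n * c (real n + a * t + 1)))"
    by (rule sums_Suc_imp[rotated]) (simp add: d_0)
  have s2: "(\<lambda>n. a * (e (lam * t) n * c' (real n + a * t))) sums
      (a * (\<Sum>n. e (lam * t) n * c' (real n + a * t)))"
    by (rule sums_mult[OF summable_sums[OF summable[where g=c', OF B']]])
  have "(\<Sum>n. f' n t) = lam * (\<Sum>n. e (lam * t) n * c (real n + a * t + 1)) +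
      a * (\<Sum>n. e (lam * t) n * c' (real n + a * t))"
    using sums_add[OF s1' s2] by (simp add: f'_def sums_iff mult_ac)
  with * show ?thesis
    by (simp add: e_def)
qed

section \<open>Poisson mixtures identified by generating functions\<close>

text \<open>The difference of the two series sums to 0 near the origin. Evaluation at 0 kills its
  constant coefficient; a nonzero later coefficient would make the zero at the origin isolated,
  which is absurd for the zero function.\<close>

lemma powser_coeffs_unique:
  fixes a b :: "nat \<Rightarrow> 'a::{real_normed_field,banach}"
  assumes "0 < r"
    and a: "\<And>z. norm z < r \<Longrightarrow> (\<lambda>n. a n * z ^ n) sums f z"
    and b: "\<And>z. norm z < r \<Longrightarrow> (\<lambda>n. b n * z ^ n) sums f z"
  shows "a = b"
proof (rule ccontr)
  assume "a \<noteq> b"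
  then obtain m where m: "a m - b m \<noteq> 0"
    by (auto simp: fun_eq_iff)
  have sums: "(\<lambda>n. (a n - b n) * (z - 0) ^ n) sums 0" if "norm (z - 0) < r" for z
    using sums_diff[OF a[of z] b[of z]] that by (simp add: algebra_simps)
  have "a 0 - b 0 = 0"
    using sums[of 0] \<open>0 < r\<close> by simp
  with m have "0 < m"
    by (cases m) auto
  show False
  proof (rule powser_0_nonzero[OF \<open>0 < r\<close> sums refl m \<open>0 < m\<close>])
    fix s :: real assume "0 < s" and s: "\<And>z::'a. z \<in> cball 0 s - {0} \<Longrightarrow> (0::'a) \<noteq> 0"
    then show False
      using s[of "of_real s"] by simp
  qed
qed

text \<open>A plain formula in the rate, meaningful also at rate 0, where \<open>0 ^ 0 = 1\<close>
  yields the point mass at 0; the random rate may take that value.\<close>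

definition poisson_mass :: "real \<Rightarrow> nat \<Rightarrow> real" where
  "poisson_mass r k = exp (- r) * r ^ k / fact k"

lemma poisson_mass_nonneg: "0 \<le> r \<Longrightarrow> 0 \<le> poisson_mass r k"
  by (simp add: poisson_mass_def)

lemma poisson_mass_generating_function:
  "(\<lambda>k. poisson_mass r k * z ^ k) sums exp (- (r * (1 - z)))"
proof -
  have "(\<lambda>k. exp (- r) * ((r * z) ^ k /\<^sub>R fact k)) sums (exp (- r) * exp (r * z))"
    by (intro sums_mult exp_converges)
  then show ?thesis
    by (simp add: poisson_mass_def power_mult_distrib field_simps flip: exp_add)
qed

lemma poisson_mass_le_1:
  assumes "0 \<le> r"
  shows "poisson_mass r k \<le> 1"
proof -
  have "poisson_mass r sums 1"
    using poisson_mass_generating_function[of r 1] by simp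
  then have "sum (poisson_mass r) {k} \<le> 1"
    using sum_le_suminf[of "poisson_mass r" "{k}"] poisson_mass_nonneg[OF assms]
    by (simp add: sums_iff)
  then show ?thesis by simp
qed

text \<open>Sum and expectation are interchanged: the expected masses are at most 1, so the
  geometric series in \<open>\<bar>z\<bar>\<close> dominates.\<close>

lemma (in prob_space) expectation_poisson_mass_generating_function:
  assumes [measurable]: "Y \<in> borel_measurable M" and Y: "\<And>\<omega>. \<omega> \<in> space M \<Longrightarrow> 0 \<le> Y \<omega>"
    and "\<bar>z\<bar> < 1"
  shows "(\<lambda>k. expectation (\<lambda>\<omega>. poisson_mass (Y \<omega>) k) * z ^ k) sums
    expectation (\<lambda>\<omega>. exp (- (Y \<omega> * (1 - z))))"
proof -
  have [measurable]: "(\<lambda>\<omega>. poisson_mass (Y \<omega>) k) \<in> borel_measurable M" for k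
    unfolding poisson_mass_def by measurable
  have bound: "norm (poisson_mass (Y \<omega>) k) \<le> 1" if "\<omega> \<in> space M" for \<omega> k
    using poisson_mass_nonneg poisson_mass_le_1 Y[OF that] by simp
  have int: "integrable M (\<lambda>\<omega>. poisson_mass (Y \<omega>) k)" for k
    by (rule integrable_const_bound[where B=1]) (auto intro!: AE_I2 bound simp del: real_norm_def)
  have *: "(\<lambda>k. norm (poisson_mass (Y \<omega>) k * z ^ k)) = (\<lambda>k. poisson_mass (Y \<omega>) k * \<bar>z\<bar> ^ k)"
    if "\<omega> \<in> space M" for \<omega>
    using poisson_mass_nonneg[OF Y[OF that]] by (simp add: abs_mult power_abs)
  have le_1: "expectation (\<lambda>\<omega>. poisson_mass (Y \<omega>) k) \<le> 1" for k
    using bound by (intro integral_le_const int) (auto intro!: AE_I2 poisson_mass_le_1 Y)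
  have "(\<lambda>k. expectation (\<lambda>\<omega>. poisson_mass (Y \<omega>) k * z ^ k)) sums
    expectation (\<lambda>\<omega>. \<Sum>k. poisson_mass (Y \<omega>) k * z ^ k)"
  proof (rule sums_integral)
    show "integrable M (\<lambda>\<omega>. poisson_mass (Y \<omega>) k * z ^ k)" for k
      by (intro integrable_mult_left int)
    show "AE \<omega> in M. summable (\<lambda>k. norm (poisson_mass (Y \<omega>) k * z ^ k))"
      using * poisson_mass_generating_function by (intro AE_I2) (auto simp: sums_iff)
    show "summable (\<lambda>k. expectation (\<lambda>\<omega>. norm (poisson_mass (Y \<omega>) k * z ^ k)))"
    proof (rule summable_comparison_test'[where N=0])
      show "summable (\<lambda>k. \<bar>z\<bar> ^ k)"
        using \<open>\<bar>z\<bar> < 1\<close> by (intro summable_geometric) simp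
      have "expectation (\<lambda>\<omega>. norm (poisson_mass (Y \<omega>) k * z ^ k)) =
          expectation (\<lambda>\<omega>. poisson_mass (Y \<omega>) k) * \<bar>z\<bar> ^ k" for k
        using *[THEN fun_cong, of _ k] int by (simp cong: Bochner_Integration.integral_cong)
      moreover have "0 \<le> expectation (\<lambda>\<omega>. poisson_mass (Y \<omega>) k)" for k
        by (intro integral_nonneg_AE AE_I2 poisson_mass_nonneg Y)
      ultimately show "norm (expectation (\<lambda>\<omega>. norm (poisson_mass (Y \<omega>) k * z ^ k))) \<le> \<bar>z\<bar> ^ k" for k
        using le_1[of k] by (simp add: mult_left_le_one_le)
    qed
  qed
  moreover have "(\<Sum>k. poisson_mass (Y \<omega>) k * z ^ k) = exp (- (Y \<omega> * (1 - z)))" for \<omega>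
    using poisson_mass_generating_function by (simp add: sums_iff)
  ultimately show ?thesis
    by simp
qed

text \<open>Both sides have the same generating function on the open unit interval around 0. There
  \<open>l * (1 - z)\<close> is nonnegative, so the Laplace transform of \<open>Y\<close> is known
  at that point.\<close>

lemma (in prob_space) expectation_poisson_mass_gamma:
  assumes "0 < l" "0 < \<beta>"
    and [measurable]: "Y \<in> borel_measurable M" and Y: "\<And>\<omega>. \<omega> \<in> space M \<Longrightarrow> 0 \<le> Y \<omega>"
    and laplace: "\<And>u. 0 \<le> u \<Longrightarrow> expectation (\<lambda>\<omega>. exp (- u * Y \<omega>)) = exp (- (x * ln (1 + u / \<beta>)))"
  shows "expectation (\<lambda>\<omega>. poisson_mass (l * Y \<omega>) k) = nbinomial (l / (l + \<beta>)) x k"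
proof -
  define p where "p = l / (l + \<beta>)"
  have p: "0 < p" "p < 1" and one_minus_p: "1 - p = \<beta> / (l + \<beta>)"
    using assms(1,2) by (auto simp: p_def field_simps)
  have "(\<lambda>k. expectation (\<lambda>\<omega>. poisson_mass (l * Y \<omega>) k)) = nbinomial p x"
  proof (rule powser_coeffs_unique)
    fix z :: real assume z: "norm z < 1"
    then have "l * z < l * 1"
      using assms(1) by (intro mult_strict_left_mono) auto
    then have pos: "0 < l + \<beta> - l * z" "0 < 1 + l * (1 - z) / \<beta>"
      using assms(2) by (simp_all add: field_simps add_pos_pos)
    have "(1 - p) / (1 - p * z) = inverse (1 + l * (1 - z) / \<beta>)"
    proof -
      have "1 - p * z = (l + \<beta> - l * z) / (l + \<beta>)" "1 + l * (1 - z) / \<beta> = (l + \<beta> - l * z) / \<beta>"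
        using assms(1,2) by (simp_all add: p_def field_simps)
      then show ?thesis
        using assms(1,2) by (simp add: one_minus_p)
    qed
    then have "((1 - p) / (1 - p * z)) powr x = exp (- (x * ln (1 + l * (1 - z) / \<beta>)))"
      using pos(2) by (simp add: powr_def ln_inverse)
    also have "\<dots> = expectation (\<lambda>\<omega>. exp (- (l * Y \<omega> * (1 - z))))"
      using laplace[of "l * (1 - z)"] assms(1) z by (simp add: mult_ac)
    finally show "(\<lambda>k. expectation (\<lambda>\<omega>. poisson_mass (l * Y \<omega>) k) * z ^ k) sums
        ((1 - p) / (1 - p * z)) powr x"
      using expectation_poisson_mass_generating_function[of "\<lambda>\<omega>. l * Y \<omega>" z] Y z assms(1) by simp
    show "(\<lambda>k. nbinomial p x k * z ^ k) sums ((1 - p) / (1 - p * z)) powr x"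
      using z by (intro nbinomial_sums p) simp
  qed simp
  then show ?thesis
    by (simp add: p_def fun_eq_iff)
qed

section \<open>A Poisson process at an independent random time\<close>

lemma (in prob_space) sums_expectation_nat_valued:
  fixes g :: "nat \<Rightarrow> real"
  assumes [measurable]: "J \<in> measurable M (count_space UNIV)" and B: "\<And>j. \<bar>g j\<bar> \<le> B"
  shows "(\<lambda>j. prob {\<omega> \<in> space M. J \<omega> = j} * g j) sums expectation (\<lambda>\<omega>. g (J \<omega>))"
proof -
  let ?A = "\<lambda>j. {\<omega> \<in> space M. J \<omega> = j}"
  have "(\<lambda>j. prob (?A j)) sums prob (\<Union>j. ?A j)"
    by (rule finite_measure_UNION) (auto simp: disjoint_family_on_def)
  then have "summable (\<lambda>j. prob (?A j) * B)"
    by (intro summable_mult2) (simp add: sums_iff)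
  then have summable: "summable (\<lambda>j. prob (?A j) * \<bar>g j\<bar>)"
    using B by (rule_tac summable_comparison_test'[where N=0]) (auto intro!: mult_left_mono)
  have "(\<lambda>j. expectation (\<lambda>\<omega>. indicator (?A j) \<omega> * g j)) sums
      expectation (\<lambda>\<omega>. \<Sum>j. indicator (?A j) \<omega> * g j)"
  proof (rule sums_integral)
    show "integrable M (\<lambda>\<omega>. indicator (?A j) \<omega> * g j)" for j
      by (intro integrable_mult_left integrable_real_indicator) (auto simp: emeasure_eq_measure)
    show "AE \<omega> in M. summable (\<lambda>j. norm (indicator (?A j) \<omega> * g j))"
      by (intro AE_I2 summable_finite[of "{J \<omega>}" for \<omega>]) (auto simp: indicator_def)
    show "summable (\<lambda>j. expectation (\<lambda>\<omega>. norm (indicator (?A j) \<omega> * g j)))"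
      using summable by (simp add: abs_mult)
  qed
  moreover have "(\<Sum>j. indicator (?A j) \<omega> * g j) = g (J \<omega>)" if "\<omega> \<in> space M" for \<omega>
    using that suminf_finite[of "{J \<omega>}" "\<lambda>j. indicator (?A j) \<omega> * g j"] by (simp add: indicator_def)
  ultimately show ?thesis
    by (simp cong: Bochner_Integration.integral_cong)
qed

text \<open>The definition provides Borel measurability of \<open>real (N t \<omega>)\<close>; for a
  countable target, preimages of singletons suffice.\<close>

lemma poisson_process_measurable:
  assumes "poisson_process M r N" "0 \<le> t"
  shows "N t \<in> measurable M (count_space UNIV)"
proof (subst measurable_count_space_eq2_countable, safe)
  fix n
  have [measurable]: "(\<lambda>\<omega>. real (N t \<omega>)) \<in> borel_measurable M"
    using assms by (auto simp: poisson_process_def subordinator_def)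
  have "{\<omega> \<in> space M. real (N t \<omega>) = real n} \<in> sets M"
    by measurable
  also have "{\<omega> \<in> space M. real (N t \<omega>) = real n} = N t -` {n} \<inter> space M"
    by auto
  finally show "N t -` {n} \<inter> space M \<in> sets M" .
qed auto

lemma poisson_process_prob:
  assumes "poisson_process M r N" "0 < r" "0 < t"
  shows "measure M {\<omega> \<in> space M. N t \<omega> = k} = poisson_mass (r * t) k"
proof -
  have "measure M {\<omega> \<in> space M. N t \<omega> = k} = measure (distr M (count_space UNIV) (N t)) {k}"
    using poisson_process_measurable[OF assms(1), of t] assms(3)
    by (subst measure_distr) (auto intro!: arg_cong[where f="measure M"])
  also have "\<dots> = pmf (poisson_pmf (r * t)) k"
    using assms by (simp add: poisson_process_def measure_pmf_single)
  also have "\<dots> = poisson_mass (r * t) k"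
    using assms by (simp add: poisson_mass_def)
  finally show ?thesis .
qed

lemma subordinator_nonneg:
  assumes "subordinator M X" "0 \<le> t" "\<omega> \<in> space M"
  shows "0 \<le> X t \<omega>"
proof -
  have "X 0 \<omega> \<le> X t \<omega>"
    using assms by (intro mono_onD[of "{0..}" "\<lambda>t. X t \<omega>"]) (auto simp: subordinator_def)
  then show ?thesis
    using assms by (simp add: subordinator_def)
qed

text \<open>For nonnegative \<open>y\<close>, the least multiple of \<open>1 / Suc m\<close>
  strictly above \<open>y\<close>. Strictness makes the approximation come from the right, as right
  continuity demands.\<close>

definition grid_above :: "nat \<Rightarrow> real \<Rightarrow> real" where
  "grid_above m y = (real (nat \<lfloor>real (Suc m) * y\<rfloor>) + 1) / real (Suc m)"

lemma grid_above_gt: "y < grid_above m y"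
proof -
  have "real (Suc m) * y < real (nat \<lfloor>real (Suc m) * y\<rfloor>) + 1"
    by linarith
  then show ?thesis
    by (simp add: grid_above_def pos_less_divide_eq mult.commute del: of_nat_Suc)
qed

lemma grid_above_le:
  assumes "0 \<le> y"
  shows "grid_above m y \<le> y + inverse (real (Suc m))"
proof -
  have "0 \<le> real (Suc m) * y"
    using assms by simp
  then have "real (nat \<lfloor>real (Suc m) * y\<rfloor>) \<le> real (Suc m) * y"
    by linarith
  then show ?thesis
    by (simp add: grid_above_def field_simps del: of_nat_Suc)
qed

lemma filterlim_grid_above:
  assumes "0 \<le> y"
  shows "filterlim (\<lambda>m. grid_above m y) (at_right y) sequentially"
proof (rule tendsto_imp_filterlim_at_right)
  show "(\<lambda>m. grid_above m y) \<longlonglongrightarrow> y"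
    by (rule tendsto_sandwich[OF always_eventually always_eventually tendsto_const
          LIMSEQ_inverse_real_of_nat_add])
      (use grid_above_gt[THEN less_imp_le] grid_above_le[OF assms] in auto)
qed (simp add: grid_above_gt)

lemma eventually_nat_eq_of_tendsto_real:
  fixes f :: "'a \<Rightarrow> nat"
  assumes "((\<lambda>x. real (f x)) \<longlongrightarrow> real n) F"
  shows "eventually (\<lambda>x. f x = n) F"
proof -
  have "eventually (\<lambda>x. dist (real (f x)) (real n) < 1) F"
    using assms by (rule tendstoD) simp
  then show ?thesis
    by eventually_elim (auto simp: dist_real_def)
qed

text \<open>Right continuity lets the random time be replaced by grid points strictly above it; on
  each grid cell only the independence of finitely many coordinates is used, so no joint
  measurability of the paths is required.\<close>

lemma (in prob_space)
  assumes N: "poisson_process M r N" and r: "0 < r"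
    and Y [measurable]: "Y \<in> borel_measurable M" and Y_nonneg: "\<And>\<omega>. \<omega> \<in> space M \<Longrightarrow> 0 \<le> Y \<omega>"
    and A [measurable]: "A \<in> events"
    and indep: "\<And>u B. 0 < u \<Longrightarrow> B \<in> sets borel \<Longrightarrow>
      prob (A \<inter> {\<omega> \<in> space M. Y \<omega> \<in> B \<and> N u \<omega> = k}) =
      prob A * prob {\<omega> \<in> space M. Y \<omega> \<in> B} * prob {\<omega> \<in> space M. N u \<omega> = k}"
  shows poisson_at_random_time_event: "{\<omega> \<in> space M. N (Y \<omega>) \<omega> = k} \<in> events" (is "?E \<in> _")
    and prob_poisson_at_random_time:
      "prob (A \<inter> {\<omega> \<in> space M. N (Y \<omega>) \<omega> = k}) = prob A * expectation (\<lambda>\<omega>. poisson_mass (r * Y \<omega>) k)"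
proof -
  \<comment> \<open>\<open>J m\<close> is the index of the grid cell containing \<open>Y\<close>,
    and \<open>v m j\<close> is the right end of cell \<open>j\<close>. It is positive even for
    \<open>j = 0\<close>, so that \<open>N (v m j)\<close> has a Poisson law with positive
    rate.\<close>
  define J where "J m \<omega> = nat \<lfloor>real (Suc m) * Y \<omega>\<rfloor>" for m \<omega>
  define v where "v m j = (real j + 1) / real (Suc m)" for m j
  have v_pos: "0 < v m j" for m j
    by (simp add: v_def add_nonneg_pos)
  have grid: "grid_above m (Y \<omega>) = v m (J m \<omega>)" for m \<omega>
    by (simp add: grid_above_def v_def J_def)
  have J [measurable]: "J m \<in> measurable M (count_space UNIV)" for m
    unfolding J_def by measurable
  have N_v [measurable]: "N (v m j) \<in> measurable M (count_space UNIV)" for m j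
    using poisson_process_measurable[OF N] v_pos[of m j] by simp
  have N_J: "(\<lambda>\<omega>. N (v m (J m \<omega>)) \<omega>) \<in> measurable M (count_space UNIV)" for m
    by (rule measurable_compose_countable[OF N_v J])
  define I where "I m \<omega> = (indicator {k} (N (v m (J m \<omega>)) \<omega>) :: real)" for m \<omega>
  have I [measurable]: "I m \<in> borel_measurable M" for m
    unfolding I_def by (rule measurable_compose[OF N_J]) simp
  have lim: "(\<lambda>m. I m \<omega>) \<longlonglongrightarrow> indicator ?E \<omega>" if \<omega>: "\<omega> \<in> space M" for \<omega>
  proof -
    \<comment> \<open>An integer-valued path that converges is eventually constant, so
      \<open>I m \<omega>\<close> eventually equals the limiting indicator.\<close>
    have "continuous (at_right (Y \<omega>)) (\<lambda>t. real (N t \<omega>))"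
      using N Y_nonneg[OF \<omega>] \<omega> by (simp add: poisson_process_def subordinator_def)
    then have "((\<lambda>t. real (N t \<omega>)) \<longlongrightarrow> real (N (Y \<omega>) \<omega>)) (at_right (Y \<omega>))"
      by (simp add: continuous_within)
    from filterlim_compose[OF this filterlim_grid_above[OF Y_nonneg[OF \<omega>]]]
    have "eventually (\<lambda>m. N (v m (J m \<omega>)) \<omega> = N (Y \<omega>) \<omega>) sequentially"
      by (intro eventually_nat_eq_of_tendsto_real) (simp add: grid)
    then have "eventually (\<lambda>m. I m \<omega> = indicator ?E \<omega>) sequentially"
      by eventually_elim (use \<omega> in \<open>simp add: I_def indicator_def\<close>)
    then show ?thesis
      by (rule tendsto_eventually)
  qed
  have ind: "(indicator ?E :: _ \<Rightarrow> real) \<in> borel_measurable M"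
    by (rule borel_measurable_LIMSEQ_real[OF lim I])
  have "?E = {\<omega> \<in> space M. indicator ?E \<omega> = (1::real)}"
    by (auto simp: indicator_def)
  also have "\<dots> \<in> events"
    using ind by measurable
  finally show E [measurable]: "?E \<in> events" .

  have step: "expectation (\<lambda>\<omega>. indicator A \<omega> * I m \<omega>) =
      prob A * expectation (\<lambda>\<omega>. poisson_mass (r * v m (J m \<omega>)) k)" for m
  proof -
    \<comment> \<open>On the cell \<open>J m \<omega> = j\<close> the time is the constant
      \<open>v m j\<close>, and membership in the cell is a Borel condition on \<open>Y\<close>;
      this is the form in which \<open>indep\<close> applies.\<close>
    let ?D = "\<lambda>j. A \<inter> {\<omega> \<in> space M. J m \<omega> = j \<and> N (v m j) \<omega> = k}"
    have "indicator A \<omega> * I m \<omega> = indicator (\<Union>j. ?D j) \<omega>" for \<omega>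
      using sets.sets_into_space[OF A] by (auto simp: I_def indicator_def)
    then have "expectation (\<lambda>\<omega>. indicator A \<omega> * I m \<omega>) = prob (\<Union>j. ?D j)"
      using sets.sets_into_space[OF A] by (simp add: Int_absorb2 le_infI1 UN_least)
    moreover have "(\<lambda>j. prob (?D j)) sums prob (\<Union>j. ?D j)"
      by (rule finite_measure_UNION) (auto simp: disjoint_family_on_def)
    moreover have "prob (?D j) = prob A * (prob {\<omega> \<in> space M. J m \<omega> = j} * poisson_mass (r * v m j) k)" for j
    proof -
      have [measurable]: "{y. nat \<lfloor>real (Suc m) * y\<rfloor> = j} \<in> sets borel"
        by measurable
      from indep[OF v_pos[of m j] this] show ?thesis
        using poisson_process_prob[OF N r v_pos[of m j], of k] by (simp add: J_def)
    qed
    moreover have "(\<lambda>j. prob A * (prob {\<omega> \<in> space M. J m \<omega> = j} * poisson_mass (r * v m j) k)) sums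
        (prob A * expectation (\<lambda>\<omega>. poisson_mass (r * v m (J m \<omega>)) k))"
      using r v_pos[of m, THEN less_imp_le]
      by (intro sums_mult sums_expectation_nat_valued[where B=1])
        (auto simp: poisson_mass_nonneg poisson_mass_le_1)
    ultimately show ?thesis
      by (simp add: sums_iff)
  qed
  \<comment> \<open>Both sides of \<open>step\<close> converge by dominated convergence with bound
    1, the right one since the Poisson mass is continuous in its rate. Uniqueness of limits then
    gives the claim.\<close>
  have "(\<lambda>m. expectation (\<lambda>\<omega>. indicator A \<omega> * I m \<omega>)) \<longlonglongrightarrow> expectation (\<lambda>\<omega>. indicator A \<omega> * indicator ?E \<omega>)"
  proof (rule integral_dominated_convergence[where w="\<lambda>_. 1"])
    show "AE \<omega> in M. (\<lambda>m. indicator A \<omega> * I m \<omega>) \<longlonglongrightarrow> indicator A \<omega> * indicator ?E \<omega>"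
      by (intro AE_I2 tendsto_mult tendsto_const lim)
  qed (auto simp: I_def indicator_def)
  moreover have "expectation (\<lambda>\<omega>. indicator A \<omega> * indicator ?E \<omega>) = prob (A \<inter> ?E)"
    using sets.sets_into_space[OF A] by (simp add: Int_absorb2 le_infI1 flip: indicator_inter_arith)
  moreover have "(\<lambda>m. prob A * expectation (\<lambda>\<omega>. poisson_mass (r * v m (J m \<omega>)) k)) \<longlonglongrightarrow>
      prob A * expectation (\<lambda>\<omega>. poisson_mass (r * Y \<omega>) k)"
  proof (intro tendsto_mult tendsto_const integral_dominated_convergence[where w="\<lambda>_. 1"])
    show "AE \<omega> in M. (\<lambda>m. poisson_mass (r * v m (J m \<omega>)) k) \<longlonglongrightarrow> poisson_mass (r * Y \<omega>) k"
    proof (rule AE_I2)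
      fix \<omega> assume "\<omega> \<in> space M"
      from filterlim_grid_above[OF Y_nonneg[OF this]]
      have "(\<lambda>m. v m (J m \<omega>)) \<longlonglongrightarrow> Y \<omega>"
        by (simp add: filterlim_at grid)
      then show "(\<lambda>m. poisson_mass (r * v m (J m \<omega>)) k) \<longlonglongrightarrow> poisson_mass (r * Y \<omega>) k"
        unfolding poisson_mass_def by (intro tendsto_intros) auto
    qed
    show "AE \<omega> in M. norm (poisson_mass (r * v m (J m \<omega>)) k) \<le> 1" for m
      using r v_pos[of m, THEN less_imp_le] by (simp add: poisson_mass_nonneg poisson_mass_le_1)
  qed (auto simp: poisson_mass_def)
  ultimately show "prob (A \<inter> ?E) = prob A * expectation (\<lambda>\<omega>. poisson_mass (r * Y \<omega>) k)"
    using step LIMSEQ_unique by (simp only:)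
qed

text \<open>Evaluation at a fixed time is measurable on the product space, so independence of whole
  paths passes to single values. \<open>T\<close> and \<open>D\<close> index the three times and
  sets in the order of the list.\<close>

lemma (in prob_space) independent_processes_prob:
  assumes "independent_processes M [X, Y, Z]" "0 \<le> s" "0 \<le> t" "0 \<le> u"
    and "A \<in> sets borel" "B \<in> sets borel" "C \<in> sets borel"
  shows "prob {\<omega> \<in> space M. X s \<omega> \<in> A \<and> Y t \<omega> \<in> B \<and> Z u \<omega> \<in> C} =
    prob {\<omega> \<in> space M. X s \<omega> \<in> A} * prob {\<omega> \<in> space M. Y t \<omega> \<in> B} * prob {\<omega> \<in> space M. Z u \<omega> \<in> C}"
proof -
  define T where "T i = [s, t, u] ! i" for i :: nat
  define D where "D i = [A, B, C] ! i" for i :: nat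
  have three: "{..<length [X, Y, Z]} = {0, 1, 2}"
    by auto
  have T: "T i \<in> {0..}" if "i \<in> {..<length [X, Y, Z]}" for i
    using that assms(2-4) by (auto simp: T_def less_Suc_eq)
  have "indep_vars (\<lambda>_. borel)
      (\<lambda>i \<omega>. (\<lambda>t\<in>{0..}. ([X, Y, Z] ! i) t \<omega>) (T i)) {..<length [X, Y, Z]}"
    using assms(1) unfolding independent_processes_def
    by (rule indep_vars_compose2[where Y="\<lambda>i f. f (T i)"]) (intro measurable_component_singleton T)
  then have "indep_vars (\<lambda>_. borel) (\<lambda>i. ([X, Y, Z] ! i) (T i)) {0, 1, 2}"
    unfolding three using assms(2-4) by (subst (asm) indep_vars_cong[OF refl]) (auto simp: T_def)
  moreover have "D i \<in> sets borel" if "i \<in> {0, 1, 2}" for i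
    using that assms(5-7) by (auto simp: D_def)
  ultimately have "prob (\<Inter>i\<in>{0, 1, 2}. ([X, Y, Z] ! i) (T i) -` D i \<inter> space M) =
      (\<Prod>i\<in>{0, 1, 2}. prob (([X, Y, Z] ! i) (T i) -` D i \<inter> space M))"
    by (intro indep_varsD[where M'="\<lambda>_. borel" and I="{0, 1, 2}"]) auto
  moreover have "(\<Inter>i\<in>{0, 1, 2}. ([X, Y, Z] ! i) (T i) -` D i \<inter> space M) =
      {\<omega> \<in> space M. X s \<omega> \<in> A \<and> Y t \<omega> \<in> B \<and> Z u \<omega> \<in> C}"
    by (auto simp: T_def D_def)
  ultimately show ?thesis
    by (simp add: T_def D_def vimage_def Int_def conj_commute mult.assoc)
qed

section \<open>The differential equation for the mixture\<close>

text \<open>The term \<open>- lam * P k t\<close> comes from the factor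
  \<open>exp (- lam * t)\<close>, the convolution with \<open>nbinomial p \<alpha>\<close> from the
  shift of time by 1, and the last group from the drift \<open>a\<close>.\<close>

lemma has_real_derivative_poisson_nbinomial_mixture:
  assumes p: "0 < p" "p < 1" and "0 < \<alpha>" "0 < a" "0 < t"
    and P: "\<And>j x. 0 < x \<Longrightarrow>
      (\<lambda>n. poisson_mass (lam * x) n * nbinomial p (\<alpha> * (real n + a * x)) j) sums P j x"
  shows "(P k has_real_derivative
      - lam * P k t + lam * (\<Sum>m\<le>k. nbinomial p \<alpha> m * P (k - m) t) +
      a * \<alpha> * (ln (1 - p) * P k t + (\<Sum>m=1..k. p ^ m / m * P (k - m) t))) (at t)"
proof -
  define c where "c j s = nbinomial p (\<alpha> * s) j" for j s
  define c' where "c' s = \<alpha> * (ln (1 - p) * c k s + (\<Sum>m=1..k. p ^ m / m * c (k - m) s))" for s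
  have c_deriv: "(c k has_real_derivative c' s) (at s)" for s
    unfolding c_def c'_def
    by (rule DERIV_cong[OF DERIV_chain2[where g="\<lambda>s. \<alpha> * s", OF has_real_derivative_nbinomial[OF p(2)]]])
      (auto intro!: derivative_eq_intros)
  have c_bound: "\<bar>c j s\<bar> \<le> 1" if "0 < s" for j s
    using nbinomial_nonneg[OF p, of "\<alpha> * s" j] nbinomial_le_1[OF p, of "\<alpha> * s" j] that \<open>0 < \<alpha>\<close>
    by (simp add: c_def)
  \<comment> \<open>Every \<open>c j s\<close> is at most 1 in absolute value, so the finite sum of
    the coefficients bounds the derivative uniformly in \<open>s\<close>.\<close>
  have c'_bound: "\<bar>c' s\<bar> \<le> \<alpha> * (\<bar>ln (1 - p)\<bar> * 1 + (\<Sum>m=1..k. p ^ m / m * 1))" if "0 < s" for s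
    unfolding c'_def abs_mult using \<open>0 < \<alpha>\<close> p c_bound[OF that]
    by (intro mult_mono order_trans[OF abs_triangle_ineq] order_trans[OF sum_abs] add_mono sum_mono)
      (auto simp: abs_mult intro!: mult_left_mono divide_right_mono add_nonneg_nonneg sum_nonneg simp del: mult_1_right)
  define w where "w n = poisson_mass (lam * t) n" for n
  have w: "w n = exp (- lam * t) * ((lam * t) ^ n / fact n)" for n
    by (simp add: w_def poisson_mass_def)
  have wP: "(\<lambda>n. w n * c j (real n + a * t)) sums P j t" for j
    using P[OF \<open>0 < t\<close>] by (simp add: w_def c_def)
  have "(\<lambda>n. \<Sum>m\<le>k. nbinomial p \<alpha> m * (w n * c (k - m) (real n + a * t))) sums
      (\<Sum>m\<le>k. nbinomial p \<alpha> m * P (k - m) t)"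
    by (intro sums_sum sums_mult wP)
  \<comment> \<open>A unit of time adds \<open>\<alpha>\<close> to the shape, so additivity turns
    the shift into a convolution.\<close>
  moreover have "c k (s + 1) = (\<Sum>m\<le>k. nbinomial p \<alpha> m * c (k - m) s)" for s
    using nbinomial_add[OF p(2), of \<alpha> "\<alpha> * s" k] by (simp add: c_def algebra_simps)
  ultimately have shift: "(\<lambda>n. w n * c k (real n + a * t + 1)) sums
      (\<Sum>m\<le>k. nbinomial p \<alpha> m * P (k - m) t)"
    by (simp add: sum_distrib_left mult.left_commute)
  have "(\<lambda>n. \<alpha> * (ln (1 - p) * (w n * c k (real n + a * t)) +
        (\<Sum>m=1..k. p ^ m / m * (w n * c (k - m) (real n + a * t))))) sums
      (\<alpha> * (ln (1 - p) * P k t + (\<Sum>m=1..k. p ^ m / m * P (k - m) t)))"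
    by (intro sums_mult sums_add sums_sum wP)
  then have drift: "(\<lambda>n. w n * c' (real n + a * t)) sums
      (\<alpha> * (ln (1 - p) * P k t + (\<Sum>m=1..k. p ^ m / m * P (k - m) t)))"
    by (simp add: c'_def sum_distrib_left distrib_left mult_ac)
  \<comment> \<open>The mixture without its exponential factor, in the form whose derivative is
    known as a series.\<close>
  define F where "F x = (\<Sum>n. (lam * x) ^ n / fact n * c k (real n + a * x))" for x
  have P_eq: "P k x = exp (- lam * x) * F x" if "0 < x" for x
  proof -
    have "(\<lambda>n. exp (- lam * x) * ((lam * x) ^ n / fact n * c k (real n + a * x))) sums P k x"
      using P[OF that, of k] by (simp add: poisson_mass_def c_def mult.assoc)
    from sums_mult[OF this, of "exp (lam * x)"]
    have "(\<lambda>n. (lam * x) ^ n / fact n * c k (real n + a * x)) sums (exp (lam * x) * P k x)"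
      by (simp add: mult.assoc[symmetric] flip: exp_add)
    then have "F x = exp (lam * x) * P k x"
      by (simp add: F_def sums_iff)
    then show ?thesis
      by (simp add: mult.assoc[symmetric] flip: exp_add)
  qed
  have scale: "exp (- lam * t) * (\<Sum>n. (lam * t) ^ n / fact n * g n) = S"
    if "(\<lambda>n. w n * g n) sums S" for g S
  proof -
    have "(\<lambda>n. exp (lam * t) * (w n * g n)) sums (exp (lam * t) * S)"
      by (intro sums_mult that)
    then have "(\<lambda>n. (lam * t) ^ n / fact n * g n) sums (exp (lam * t) * S)"
      by (simp add: w mult.assoc[symmetric] flip: exp_add)
    then show ?thesis
      by (simp add: sums_iff mult.assoc[symmetric] flip: exp_add)
  qed
  have "(F has_real_derivative
      lam * (\<Sum>n. (lam * t) ^ n / fact n * c k (real n + a * t + 1)) +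
      a * (\<Sum>n. (lam * t) ^ n / fact n * c' (real n + a * t))) (at t)"
    unfolding F_def[abs_def]
    by (rule has_real_derivative_poisson_series[OF \<open>0 < a\<close> \<open>0 < t\<close> c_deriv c_bound c'_bound])
  then have "((\<lambda>x. exp (- lam * x) * F x) has_real_derivative
      - lam * (exp (- lam * t) * F t) +
      (lam * (exp (- lam * t) * (\<Sum>n. (lam * t) ^ n / fact n * c k (real n + a * t + 1))) +
      a * (exp (- lam * t) * (\<Sum>n. (lam * t) ^ n / fact n * c' (real n + a * t))))) (at t)"
    by (auto intro!: derivative_eq_intros simp: algebra_simps)
  then have "((\<lambda>x. exp (- lam * x) * F x) has_real_derivative
      - lam * P k t + lam * (\<Sum>m\<le>k. nbinomial p \<alpha> m * P (k - m) t) +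
      a * \<alpha> * (ln (1 - p) * P k t + (\<Sum>m=1..k. p ^ m / m * P (k - m) t))) (at t)"
    unfolding scale[OF shift] scale[OF drift] P_eq[OF \<open>0 < t\<close>, symmetric] by (simp only: add.assoc mult.assoc)
  then show ?thesis
    \<comment> \<open>\<open>P k\<close> and the product agree on positive times, an open set
      containing \<open>t\<close>.\<close>
    by (rule has_field_derivative_transform_within_open[where S="{0<..}"])
      (use \<open>0 < t\<close> P_eq in auto)
qed

section \<open>Gamma-function form and law of the time-changed process\<close>

lemma nbinomial_eq_Gamma:
  assumes "0 < l" "0 < \<beta>" "0 < x"
  shows "nbinomial (l / (l + \<beta>)) x k =
    l ^ k / fact k * (\<beta> powr x / Gamma x * (Gamma (x + real k) / (l + \<beta>) powr (x + real k)))"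
proof -
  have "x \<notin> \<int>\<^sub>\<le>\<^sub>0"
    using assms(3) by (auto elim!: nonpos_Ints_cases)
  moreover have "1 - l / (l + \<beta>) = \<beta> / (l + \<beta>)"
    using assms by (simp add: field_simps)
  ultimately show ?thesis
    using assms by (simp add: nbinomial_def pochhammer_Gamma powr_divide powr_add powr_realpow power_divide mult_ac)
qed

text \<open>The event is split by the value of \<open>N t\<close>. Where
  \<open>N t \<omega> = n\<close>, the inner time is the deterministic
  \<open>real n + a * t\<close>, so \<open>N1\<close> is evaluated at a random time independent of
  it, with \<open>N t \<omega> = n\<close> as side event.\<close>

lemma (in prob_space) time_changed_pmf_sums:
  assumes "0 < lam1" "0 < lam" "0 < \<alpha>" "0 < \<beta>" "0 < a" "0 < t"
    and N1: "poisson_process M lam1 N1" and N: "poisson_process M lam N"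
    and G: "gamma_process M \<alpha> \<beta> G"
    and indep: "independent_processes M [\<lambda>s \<omega>. real (N1 s \<omega>), \<lambda>s \<omega>. real (N s \<omega>), G]"
  shows "(\<lambda>n. poisson_mass (lam * t) n * nbinomial (lam1 / (lam1 + \<beta>)) (\<alpha> * (real n + a * t)) k)
    sums time_changed_pmf M N1 G N a k t"
proof -
  have sub: "subordinator M G" and laplace: "has_laplace_exponent M G (\<lambda>u. \<alpha> * ln (1 + u / \<beta>))"
    using G by (auto simp: gamma_process_def)
  define s where "s n = real n + a * t" for n
  have s: "0 \<le> s n" for n
    using assms by (simp add: s_def)
  have G_meas: "G (s n) \<in> borel_measurable M" for n
    using sub s by (simp add: subordinator_def)
  have G_nonneg: "0 \<le> G (s n) \<omega>" if "\<omega> \<in> space M" for n \<omega>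
    using subordinator_nonneg[OF sub s that] .
  define A where "A n = {\<omega> \<in> space M. N t \<omega> = n}" for n
  have [measurable]: "N t \<in> measurable M (count_space UNIV)"
    using poisson_process_measurable[OF N] \<open>0 < t\<close> by simp
  have A: "A n \<in> events" for n
    unfolding A_def by measurable
  have indep_A: "prob (A n \<inter> {\<omega> \<in> space M. G (s n) \<omega> \<in> B \<and> N1 u \<omega> = k}) =
      prob (A n) * prob {\<omega> \<in> space M. G (s n) \<omega> \<in> B} * prob {\<omega> \<in> space M. N1 u \<omega> = k}"
    if "0 < u" "B \<in> sets borel" for u B n
  proof -
    have "prob {\<omega> \<in> space M. real (N1 u \<omega>) \<in> {real k} \<and> real (N t \<omega>) \<in> {real n} \<and> G (s n) \<omega> \<in> B} =
        prob {\<omega> \<in> space M. real (N1 u \<omega>) \<in> {real k}} * prob {\<omega> \<in> space M. real (N t \<omega>) \<in> {real n}} *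
        prob {\<omega> \<in> space M. G (s n) \<omega> \<in> B}"
      using that \<open>0 < t\<close> s by (intro independent_processes_prob[OF indep]) auto
    moreover have "A n \<inter> {\<omega> \<in> space M. G (s n) \<omega> \<in> B \<and> N1 u \<omega> = k} =
        {\<omega> \<in> space M. N1 u \<omega> = k \<and> N t \<omega> = n \<and> G (s n) \<omega> \<in> B}"
      by (auto simp: A_def)
    ultimately show ?thesis
      by (simp add: A_def mult_ac)
  qed
  have prob: "prob (A n \<inter> {\<omega> \<in> space M. N1 (G (s n) \<omega>) \<omega> = k}) =
      poisson_mass (lam * t) n * nbinomial (lam1 / (lam1 + \<beta>)) (\<alpha> * s n) k" for n
  proof -
    have "prob (A n \<inter> {\<omega> \<in> space M. N1 (G (s n) \<omega>) \<omega> = k}) =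
        prob (A n) * expectation (\<lambda>\<omega>. poisson_mass (lam1 * G (s n) \<omega>) k)"
      by (rule prob_poisson_at_random_time[OF N1 \<open>0 < lam1\<close> G_meas G_nonneg A indep_A])
    also have "prob (A n) = poisson_mass (lam * t) n"
      unfolding A_def by (rule poisson_process_prob[OF N \<open>0 < lam\<close> \<open>0 < t\<close>])
    also have "expectation (\<lambda>\<omega>. poisson_mass (lam1 * G (s n) \<omega>) k) =
        nbinomial (lam1 / (lam1 + \<beta>)) (\<alpha> * s n) k"
      using laplace s[of n]
      by (intro expectation_poisson_mass_gamma \<open>0 < lam1\<close> \<open>0 < \<beta>\<close> G_meas G_nonneg)
        (auto simp: has_laplace_exponent_def mult_ac)
    finally show ?thesis .
  qed
  have events: "A n \<inter> {\<omega> \<in> space M. N1 (G (s n) \<omega>) \<omega> = k} \<in> events" for n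
    using A poisson_at_random_time_event[OF N1 \<open>0 < lam1\<close> G_meas G_nonneg A indep_A] by blast
  have "(\<lambda>n. prob (A n \<inter> {\<omega> \<in> space M. N1 (G (s n) \<omega>) \<omega> = k})) sums
      prob (\<Union>n. A n \<inter> {\<omega> \<in> space M. N1 (G (s n) \<omega>) \<omega> = k})"
    using events by (intro finite_measure_UNION) (auto simp: disjoint_family_on_def A_def)
  moreover have "(\<Union>n. A n \<inter> {\<omega> \<in> space M. N1 (G (s n) \<omega>) \<omega> = k}) =
      {\<omega> \<in> space M. N1 (time_changed G N a t \<omega>) \<omega> = k}"
    by (auto simp: A_def s_def time_changed_def)
  ultimately have "(\<lambda>n. poisson_mass (lam * t) n * nbinomial (lam1 / (lam1 + \<beta>)) (\<alpha> * s n) k) sums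
      time_changed_pmf M N1 G N a k t"
    by (simp only: prob time_changed_pmf_def)
  then show ?thesis
    by (simp only: s_def)
qed

theorem theorem5:
  fixes M :: "'w measure"
    and N1 N :: "real \<Rightarrow> 'w \<Rightarrow> nat" and G :: "real \<Rightarrow> 'w \<Rightarrow> real"
    and lam1 lam \<alpha> \<beta> a t :: real and k :: nat
  assumes "prob_space M"
    and "lam1 > 0" and "lam > 0" and "\<alpha> > 0" and "\<beta> > 0" and "a > 0"
    and "poisson_process M lam1 N1"
    and "poisson_process M lam N"
    and "gamma_process M \<alpha> \<beta> G"
    and "independent_processes M [\<lambda>s \<omega>. real (N1 s \<omega>), \<lambda>s \<omega>. real (N s \<omega>), G]"
    and "t > 0"
  shows "summable (\<lambda>n. (lam * t) ^ n / fact n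
           * (\<beta> powr (\<alpha> * (real n + a * t)) / Gamma (\<alpha> * (real n + a * t)))
           * (Gamma (\<alpha> * (real n + a * t) + real k)
              / (lam1 + \<beta>) powr (\<alpha> * (real n + a * t) + real k)))
    \<and> time_changed_pmf M N1 G N a k t =
         exp (- lam * t) * (lam1 ^ k / fact k) *
         (\<Sum>n. (lam * t) ^ n / fact n
           * (\<beta> powr (\<alpha> * (real n + a * t)) / Gamma (\<alpha> * (real n + a * t)))
           * (Gamma (\<alpha> * (real n + a * t) + real k)
              / (lam1 + \<beta>) powr (\<alpha> * (real n + a * t) + real k)))
    \<and> (time_changed_pmf M N1 G N a k has_real_derivative
          (- (a * \<alpha> * ln (1 + lam1 / \<beta>) + lam * (1 - (\<beta> / (lam1 + \<beta>)) powr \<alpha>))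
             * time_changed_pmf M N1 G N a k t
           + (\<Sum>m = 1..k. 1 / fact m * (lam1 / (lam1 + \<beta>)) ^ m
               * (a * \<alpha> * Gamma (real m)
                  + lam * (\<beta> / (lam1 + \<beta>)) powr \<alpha> * (Gamma (real m + \<alpha>) / Gamma \<alpha>))
               * time_changed_pmf M N1 G N a (k - m) t))) (at t)"
proof -
  interpret prob_space M by fact
  define P where "P = time_changed_pmf M N1 G N a"
  define p where "p = lam1 / (lam1 + \<beta>)"
  have p: "0 < p" "p < 1" and one_minus_p: "1 - p = \<beta> / (lam1 + \<beta>)"
    using assms(2,5) by (auto simp: p_def field_simps)
  \<comment> \<open>Stated for all \<open>j\<close> and all positive \<open>x\<close>, since the
    equation involves the lower masses and the derivative a neighbourhood of
    \<open>t\<close>.\<close>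
  have P: "(\<lambda>n. poisson_mass (lam * x) n * nbinomial p (\<alpha> * (real n + a * x)) j) sums P j x"
    if "0 < x" for j x
    unfolding P_def p_def by (rule time_changed_pmf_sums[OF assms(2-6) that assms(7-10)])
  define b where "b = (\<lambda>n. (lam * t) ^ n / fact n
      * (\<beta> powr (\<alpha> * (real n + a * t)) / Gamma (\<alpha> * (real n + a * t)))
      * (Gamma (\<alpha> * (real n + a * t) + real k) / (lam1 + \<beta>) powr (\<alpha> * (real n + a * t) + real k)))"
  define C where "C = exp (- lam * t) * (lam1 ^ k / fact k)"
  have "C \<noteq> 0"
    using assms(2) by (simp add: C_def)
  have "poisson_mass (lam * t) n * nbinomial p (\<alpha> * (real n + a * t)) k = C * b n" for n
  proof -
    have "0 < \<alpha> * (real n + a * t)"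
      using assms by (simp add: add_nonneg_pos)
    then show ?thesis
      using assms(2,5) by (simp add: p_def nbinomial_eq_Gamma poisson_mass_def C_def b_def mult_ac)
  qed
  then have C_b: "(\<lambda>n. C * b n) sums P k t"
    using P[OF \<open>0 < t\<close>, of k] by simp
  \<comment> \<open>The series is known to converge only with the factor \<open>C\<close>; as
    \<open>C\<close> is nonzero, it can be divided out.\<close>
  have b: "summable b"
    using C_b \<open>C \<noteq> 0\<close> by (simp add: sums_iff summable_cmult_iff)
  have formula: "P k t = C * suminf b"
    using sums_unique2[OF C_b sums_mult[OF summable_sums[OF b]]] .

  have "ln (1 - p) = - ln (1 + lam1 / \<beta>)"
  proof -
    have "1 - p = inverse (1 + lam1 / \<beta>)"
      using assms(2,5) by (simp add: one_minus_p field_simps)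
    then show ?thesis
      using assms(2,5) by (simp add: ln_inverse add_pos_pos)
  qed
  \<comment> \<open>The jump and drift weights of \<open>P (k - m) t\<close> are merged, using
    \<open>Gamma (real m) = fact m / m\<close> and \<open>pochhammer \<alpha> m = Gamma (\<alpha> +
    m) / Gamma \<alpha>\<close>.\<close>
  have coeff: "lam * nbinomial p \<alpha> m + a * \<alpha> * (p ^ m / m) = 1 / fact m * p ^ m
      * (a * \<alpha> * Gamma (real m) + lam * (\<beta> / (lam1 + \<beta>)) powr \<alpha> * (Gamma (real m + \<alpha>) / Gamma \<alpha>))"
    if "1 \<le> m" for m
  proof -
    obtain i where i: "m = Suc i"
      using \<open>1 \<le> m\<close> by (cases m) auto
    have "Gamma (real m) = fact m / m"
      using Gamma_fact[of i, where ?'a=real] by (simp add: i)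
    moreover have "\<alpha> \<notin> \<int>\<^sub>\<le>\<^sub>0"
      using assms(4) by (auto elim!: nonpos_Ints_cases)
    ultimately show ?thesis
      by (simp add: nbinomial_def one_minus_p pochhammer_Gamma add.commute[of "real m"] algebra_simps)
  qed
  \<comment> \<open>The jump term \<open>m = 0\<close>, with weight
    \<open>(1 - p) powr \<alpha>\<close>, joins the coefficient of \<open>P k t\<close>; the others
    pair with the drift terms.\<close>
  have "{..k} = insert 0 {1..k}"
    by auto
  then have "- lam * P k t + lam * (\<Sum>m\<le>k. nbinomial p \<alpha> m * P (k - m) t) +
      a * \<alpha> * (ln (1 - p) * P k t + (\<Sum>m=1..k. p ^ m / m * P (k - m) t)) =
      (a * \<alpha> * ln (1 - p) - lam * (1 - (1 - p) powr \<alpha>)) * P k t +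
      (\<Sum>m=1..k. (lam * nbinomial p \<alpha> m + a * \<alpha> * (p ^ m / m)) * P (k - m) t)"
    by (simp add: sum_distrib_left distrib_left distrib_right sum.distrib) (simp add: algebra_simps)
  also have "\<dots> = - (a * \<alpha> * ln (1 + lam1 / \<beta>) + lam * (1 - (\<beta> / (lam1 + \<beta>)) powr \<alpha>)) * P k t +
      (\<Sum>m=1..k. 1 / fact m * p ^ m
        * (a * \<alpha> * Gamma (real m) + lam * (\<beta> / (lam1 + \<beta>)) powr \<alpha> * (Gamma (real m + \<alpha>) / Gamma \<alpha>))
        * P (k - m) t)"
    using \<open>ln (1 - p) = _\<close> by (intro arg_cong2[where f="(+)"] sum.cong refl)
      (simp add: one_minus_p algebra_simps, simp only: coeff atLeastAtMost_iff)
  finally have deriv: "(P k has_real_derivative \<dots>) (at t)"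
    using has_real_derivative_poisson_nbinomial_mixture[OF p assms(4,6,11) P, of k] by simp
  show ?thesis
    using b formula deriv unfolding P_def p_def b_def C_def by blast
qed

end
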